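(* Let $a\ge1$ and $x\ge2$ be integers, let $n=2^a$, and let $\omega_n$ be the number of distinct prime factors of $x^n-1$. Then $$x\;\ge\;\min\left[\left(1+2n\prod_{i=1}^{\omega_n}s_i\right)^{1/n},\ \left(1+\prod_{i=2}^{\omega_n+1}s_i\right)^{1/n}\right],$$ where $s_i$ denotes the $i$-th prime. *)

theory Defs
  imports "HOL-Library.Infinite_Set" "HOL-Computational_Algebra.Primes" Complex_Main
begin

text \<open>\<open>nth_prime i\<close> is the \<open>i\<close>-th prime counted from 1, so \<open>nth_prime 1 = 2\<close>. Since
  \<^const>\<open>enumerate\<close> counts from 0, the index is shifted; \<open>nth_prime 0\<close> is a junk value.\<close>

definition nth_prime :: "nat \<Rightarrow> nat" where
  "nth_prime i = enumerate {p::nat. prime p} (i - 1)"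

end

theory Submission imports Defs begin

text \<open>If \<open>x\<close> is even, then \<open>x\<^sup>n - 1\<close> has \<open>\<omega>\<close> distinct odd prime factors, whose product is at
  least that of the first \<open>\<omega>\<close> odd primes. If \<open>x\<close> is odd, then \<open>8\<close> divides \<open>x\<^sup>2 - 1\<close> and every
  further squaring contributes another factor \<open>2\<close>, so \<open>4n\<close> divides \<open>x\<^sup>n - 1\<close>; the remaining
  \<open>\<omega> - 1\<close> prime factors are odd, and one of the factors \<open>2\<close> in \<open>4n\<close> is the first prime.\<close>

text \<open>Pigeonhole: if \<open>Max T\<close> lay below the element of index \<open>k\<close>, all
  \<open>Suc k\<close> elements of \<open>T\<close> would be among the \<open>k\<close> elements
  with smaller index.\<close>

lemma enumerate_le_Max:
  fixes A :: "nat set"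
  assumes "infinite A" "finite T" "T \<subseteq> A" "card T = Suc k"
  shows "enumerate A k \<le> Max T"
proof (rule ccontr)
  assume *: "\<not> enumerate A k \<le> Max T"
  have "T \<subseteq> enumerate A ` {..<k}"
  proof
    fix t assume t: "t \<in> T"
    then obtain j where j: "t = enumerate A j"
      using assms enumerate_Ex[of A t] by blast
    have "t < enumerate A k"
      using t * assms Max_ge[of T t] by linarith
    then have "j < k"
      using assms(1) j by (simp add: enumerate_mono_iff)
    then show "t \<in> enumerate A ` {..<k}"
      using j by blast
  qed
  then have "card T \<le> card (enumerate A ` {..<k})"
    by (intro card_mono) auto
  also have "\<dots> \<le> k"
    using card_image_le[of "{..<k}" "enumerate A"] by simp
  finally show False
    using assms by simp
qed

text \<open>Induction on the cardinality: split off \<open>Max T\<close>, which dominates the last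
  enumerated factor, and apply the hypothesis to the rest.\<close>

lemma prod_enumerate_le_prod:
  fixes A :: "nat set"
  assumes "infinite A" "finite T" "T \<subseteq> A"
  shows "(\<Prod>i<card T. enumerate A i) \<le> \<Prod>T"
  using assms(2,3)
proof (induction "card T" arbitrary: T)
  case 0
  then show ?case by simp
next
  case (Suc k)
  have ne: "T \<noteq> {}" using Suc.hyps(2) by auto
  then have M: "Max T \<in> T" using Suc.prems by simp
  define U where "U = T - {Max T}"
  have U: "card U = k" "finite U" "U \<subseteq> A"
    using Suc.hyps(2) Suc.prems M by (auto simp: U_def)
  have "(\<Prod>i<card T. enumerate A i) = (\<Prod>i<card U. enumerate A i) * enumerate A k"
    using U Suc.hyps(2) by (metis prod.lessThan_Suc)
  also have "\<dots> \<le> \<Prod>U * Max T"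
    using Suc.hyps(1)[of U] U enumerate_le_Max[OF assms(1) Suc.prems] Suc.hyps(2)
    by (intro mult_mono) auto
  also have "\<dots> = \<Prod>T"
    using Suc.prems M by (simp add: U_def prod.remove[of T "Max T"] mult.commute)
  finally show ?case .
qed

text \<open>The integer version serves because \<open>prime_factors\<close> of an integer is a set
  of integers; \<open>nat\<close> is injective on primes, so the bound transfers.\<close>

lemma prod_nth_prime_le_prod:
  fixes T :: "int set"
  assumes "finite T" "\<And>p. p \<in> T \<Longrightarrow> prime p"
  shows "(\<Prod>i=1..card T. int (nth_prime i)) \<le> \<Prod>T"
proof -
  have inj: "inj_on nat T"
    using assms(2) by (intro inj_onI) (metis int_nat_eq prime_ge_0_int)
  have sub: "nat ` T \<subseteq> {p. prime p}"
    using assms(2) by auto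
  \<comment> \<open>The product starts at 1, so the subtraction \<open>i - 1\<close> in
    \<open>nth_prime\<close> never truncates.\<close>
  have "(\<Prod>i=1..card T. nth_prime i) = (\<Prod>i<card T. enumerate {p::nat. prime p} i)"
    unfolding nth_prime_def
    by (rule prod.reindex_bij_witness[of _ Suc "\<lambda>i. i - 1"]) auto
  also have "\<dots> \<le> \<Prod>(nat ` T)"
    using prod_enumerate_le_prod[OF primes_infinite _ sub] assms(1) inj
    by (simp add: card_image)
  finally have "(\<Prod>i=1..card T. int (nth_prime i)) \<le> int (\<Prod>(nat ` T))"
    by (metis of_nat_mono of_nat_prod)
  also have "int (\<Prod>(nat ` T)) = \<Prod>T"
    using assms(2) inj
    by (auto simp: prod.reindex prime_ge_0_int intro!: prod.cong)
  finally show ?thesis .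
qed

lemma nth_prime_1: "nth_prime 1 = 2"
  unfolding nth_prime_def enumerate_0 diff_self_eq_0
  by (rule Least_equality) (auto simp: prime_ge_2_nat)

text \<open>Adjoin 2 to \<open>T\<close>, apply the previous bound, and cancel the common factor
  2.\<close>

lemma prod_odd_nth_prime_le_prod:
  fixes T :: "int set"
  assumes "finite T" "\<And>p. p \<in> T \<Longrightarrow> prime p" "2 \<notin> T"
  shows "(\<Prod>i=2..card T + 1. int (nth_prime i)) \<le> \<Prod>T"
proof -
  have "(\<Prod>i=1..card (insert 2 T). int (nth_prime i)) \<le> \<Prod>(insert 2 T)"
    using assms by (intro prod_nth_prime_le_prod) auto
  moreover have "(\<Prod>i=1..card (insert 2 T). int (nth_prime i)) =
      2 * (\<Prod>i=2..card T + 1. int (nth_prime i))"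
    using assms nth_prime_1 prod.atLeast_Suc_atMost[of 1 "card T + 1" "\<lambda>i. int (nth_prime i)"]
    by (simp add: numeral_2_eq_2 del: prod.cl_ivl_Suc)
  ultimately show ?thesis
    using assms by simp
qed

lemma prod_prime_factors_dvd:
  fixes m :: "'a :: factorial_semiring_multiplicative"
  assumes "m \<noteq> 0" "S \<subseteq> prime_factors m"
  shows "\<Prod>S dvd m"
proof -
  have "\<Prod>S dvd \<Prod>(prime_factors m)"
    using assms by (intro prod_dvd_prod_subset) auto
  also have "\<dots> dvd (\<Prod>p\<in>prime_factors m. p ^ multiplicity p m)"
    using assms by (intro prod_dvd_prod dvd_power)
      (auto simp: prime_factors_multiplicity)
  also have "\<dots> dvd m"
    using assms by (simp add: prod_prime_factors)
  finally show ?thesis .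
qed

text \<open>The exponent is \<open>2 ^ Suc a\<close> so that the induction starts at
  \<open>x ^ 2 - 1\<close>.\<close>

lemma two_power_dvd_odd_power_minus_one:
  fixes x :: int
  assumes "odd x"
  shows "2 ^ (a + 3) dvd x ^ (2 ^ Suc a) - 1"
proof (induction a)
  case 0
  obtain k where k: "x = 2 * k + 1" using assms by (elim oddE)
  \<comment> \<open>Here \<open>x ^ 2 - 1\<close> equals \<open>4 * k * (k + 1)\<close>, which gives
    the third factor 2.\<close>
  have "even (k * (k + 1))" by simp
  then obtain l where "k * (k + 1) = 2 * l" by (elim evenE)
  then have "x ^ 2 - 1 = 8 * l"
    unfolding k by (simp add: power2_eq_square algebra_simps)
  then show ?case by simp
next
  case (Suc a)
  let ?y = "x ^ (2 ^ Suc a)"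
  have "even (?y + 1)" using assms by simp
  with Suc have "2 ^ (a + 3) * 2 dvd (?y - 1) * (?y + 1)"
    by (rule mult_dvd_mono)
  also have "(?y - 1) * (?y + 1) = x ^ (2 ^ Suc (Suc a)) - 1"
    by (simp add: algebra_simps mult_2 flip: power_add)
  finally show ?case by (simp add: power_add)
qed

theorem theorem1p3:
  fixes a n \<omega> :: nat and x :: int
  assumes "a \<ge> 1" and "x \<ge> 2"
    and "n = 2 ^ a"
    and "\<omega> = card (prime_factors (x ^ n - 1))"
  shows "real_of_int x \<ge>
    min ((1 + 2 * real n * (\<Prod>i=1..\<omega>. real (nth_prime i))) powr (1 / real n))
        ((1 + (\<Prod>i=2..\<omega>+1. real (nth_prime i))) powr (1 / real n))"
proof -
  define N where "N = x ^ n - 1"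
  define P where "P = prime_factors N"
  have n: "n > 0" using assms(3) by simp
  have "x ^ 1 \<le> x ^ n" using n assms(2) by (intro power_increasing) auto
  then have N: "N > 0" using assms(2) by (simp add: N_def)
  have P: "finite P" "\<And>p. p \<in> P \<Longrightarrow> prime p" "\<omega> = card P"
    using assms(4) by (auto simp: P_def N_def)
  \<comment> \<open>Taking \<open>n\<close>-th roots reduces either bound to an integer inequality
    \<open>C \<le> N\<close>.\<close>
  have root_le: "(1 + real_of_int C) powr (1 / real n) \<le> real_of_int x"
    if "0 \<le> C" "C \<le> N" for C
  proof -
    have "1 + C \<le> x ^ n" using that by (simp add: N_def)
    then have "1 + real_of_int C \<le> real_of_int x ^ n"
      by (metis of_int_1 of_int_add of_int_le_iff of_int_power)
    then have "(1 + real_of_int C) powr (1 / real n) \<le> (real_of_int x ^ n) powr (1 / real n)"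
      using that by (intro powr_mono2) auto
    also have "\<dots> = real_of_int x"
      using assms(2) n by (simp add: powr_powr flip: powr_realpow)
    finally show ?thesis .
  qed
  show ?thesis
  proof (cases "even x")
    case True
    then have "odd N" using n by (simp add: N_def)
    then have "2 \<notin> P" by (auto simp: P_def)
    \<comment> \<open>Even \<open>x\<close> yields the second argument of
      \<open>min\<close>.\<close>
    then have "(\<Prod>i=2..\<omega>+1. int (nth_prime i)) \<le> \<Prod>P"
      using P prod_odd_nth_prime_le_prod by simp
    also have "\<dots> \<le> N"
      using N by (intro zdvd_imp_le prod_prime_factors_dvd) (auto simp: P_def)
    finally have "(1 + real_of_int (\<Prod>i=2..\<omega>+1. int (nth_prime i))) powr (1 / real n) \<le> x"
      by (intro root_le prod_nonneg) auto
    then show ?thesis by (simp add: min_le_iff_disj del: prod.cl_ivl_Suc)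
  next
    case False
    define Q where "Q = P - {2}"
    \<comment> \<open>The lemma is used at \<open>a - 1\<close>, which is a genuine predecessor as
      \<open>a \<ge> 1\<close>; the divisor is \<open>4 * n\<close>.\<close>
    have "2 ^ (a + 2) dvd N"
      using two_power_dvd_odd_power_minus_one[OF False, of "a - 1"] assms(1)
      by (simp add: N_def assms(3) Suc_diff_le)
    then have dvd4: "4 * int n dvd N" by (simp add: assms(3) power_add mult.commute)
    then have "2 dvd N" by (meson dvd_mult_left dvd_trans even_numeral)
    then have two: "2 \<in> P" using N by (auto simp: P_def in_prime_factors_iff)
    have "\<Prod>Q dvd N"
      using N by (intro prod_prime_factors_dvd) (auto simp: P_def Q_def)
    \<comment> \<open>A power of 2 against a product of odd primes, so the two divisors of
      \<open>N\<close> multiply.\<close>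
    moreover have "coprime (4 * int n) (\<Prod>Q)"
    proof (rule prod_coprime_right)
      fix q assume "q \<in> Q"
      then have "coprime 2 q"
        using P(2) by (intro primes_coprime) (auto simp: Q_def)
      then have "coprime (2 ^ (a + 2)) q"
        by (rule coprime_power_left_iff[THEN iffD2, OF disjI1])
      moreover have "2 ^ (a + 2) = 4 * int n"
        by (simp add: assms(3))
      ultimately show "coprime (4 * int n) q"
        by metis
    qed
    ultimately have "4 * int n * \<Prod>Q dvd N"
      using dvd4 divides_mult by blast
    then have le: "4 * int n * \<Prod>Q \<le> N" using N by (rule zdvd_imp_le)
    have "(\<Prod>i=1..\<omega>. int (nth_prime i)) \<le> \<Prod>P"
      using prod_nth_prime_le_prod P by simp
    also have "\<Prod>P = 2 * \<Prod>Q"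
      using two P(1) by (simp add: Q_def prod.remove)
    \<comment> \<open>One 2 from \<open>4 * n\<close> is spent on the prime 2 in \<open>P\<close>,
      leaving the coefficient \<open>2 * n\<close> of the first argument of
      \<open>min\<close>.\<close>
    finally have "2 * int n * (\<Prod>i=1..\<omega>. int (nth_prime i)) \<le> 2 * int n * (2 * \<Prod>Q)"
      by (intro mult_left_mono) auto
    also have "\<dots> \<le> N" using le by simp
    finally have "(1 + real_of_int (2 * int n * (\<Prod>i=1..\<omega>. int (nth_prime i)))) powr (1 / real n) \<le> x"
      by (intro root_le mult_nonneg_nonneg prod_nonneg) auto
    then show ?thesis by simp
  qed
qed

end
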